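(* Let $\rhd$ be a system of ideals for an ordered group $G$. Then its regularisation $\vdash_{\rhd}$ is the finest regular entailment relation $\vdash$ for $G$ whose restriction to $\mathrm{P}_{\mathrm{fe}}^*(G)\times G$ is coarser than $\rhd$ (i.e. such that $A\rhd b$ implies $A\vdash b$).
   Context: Monoids and groups are commutative. An ordered group is a commutative group $G$ with a partial order $\le_G$ compatible with addition. $\mathrm{P}_{\mathrm{fe}}^*(G)$ is the set of nonempty finite subsets of $G$; $a$ stands for $\{a\}$, $A,A'$ for $A\cup A'$, $x+A=\{x+a:a\in A\}$, $A-B=\{a-b:a\in A,b\in B\}$. A system of ideals for $G$ is a relation $\rhd$ between $\mathrm{P}_{\mathrm{fe}}^*(G)$ and $G$ such that: $a\rhd a$; $A\rhd b$ implies $A,A'\rhd b$; $A\rhd c$ and $A,c\rhd b$ imply $A\rhd b$; $a\le_G b$ implies $a\rhd b$; $A\rhd b$ implies $x+A\rhd x+b$ for all $x\in G$. A relation $\rhd_2$ is coarser than $\rhd_1$ ($\rhd_1$ finer than $\rhd_2$) if $A\rhd_1 b$ implies $A\rhd_2 b$ (similarly for relations on $\mathrm{P}_{\mathrm{fe}}^*(G)$). For $y_1,\dots,y_n\in G$, $\rhd_{y_1,\dots,y_n}$ denotes the finest system of ideals coarser than $\rhd$ satisfying $0\rhd_{y_1,\dots,y_n} y_i$ for all $i$. The regularisation of $\rhd$ is the relation on $\mathrm{P}_{\mathrm{fe}}^*(G)$: $A\vdash_{\rhd}B$ iff there are $x_1,\dots,x_m\in G$ such that for every choice of signs, $A-B\rhd_{\pm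 x_1,\dots,\pm x_m}0$. An unbounded entailment relation is a relation $\vdash$ on $\mathrm{P}_{\mathrm{fe}}^*(G)$ with $a\vdash a$; $A\vdash B\Rightarrow A,A'\vdash B,B'$; ($A\vdash B,c$ and $A,c\vdash B$) $\Rightarrow A\vdash B$. It is regular if moreover $a\le_G b\Rightarrow a\vdash b$, $A\vdash B\Rightarrow x+A\vdash x+B$, and $x+a,y+b\vdash y+a,x+b$ for all $a,b,x,y\in G$. *)

theory Defs
  imports Main
begin

text \<open>
  A relation between (or on) nonempty finite subsets is a predicate on arbitrary sets that holds
  only on \<open>Pfe\<close>.  With this normalisation ``coarser than'' is the pointwise order \<open>\<le>\<close> on predicates,
  and ``finest'' means least for \<open>\<le>\<close>.
\<close>

definition Pfe :: "'a set set" where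
  "Pfe = {A. finite A \<and> A \<noteq> {}}"

locale system_of_ideals =
  fixes R :: "'a::ordered_ab_group_add set \<Rightarrow> 'a \<Rightarrow> bool"
  assumes domain: "R A b \<Longrightarrow> A \<in> Pfe"
    and refl: "R {a} a"
    and weaken: "R A b \<Longrightarrow> A' \<in> Pfe \<Longrightarrow> R (A \<union> A') b"
    and cut: "R A c \<Longrightarrow> R (A \<union> {c}) b \<Longrightarrow> R A b"
    and order: "a \<le> b \<Longrightarrow> R {a} b"
    and translate: "R A b \<Longrightarrow> R ((+) x ` A) (x + b)"

locale unbounded_entailment =
  fixes E :: "'a set \<Rightarrow> 'a set \<Rightarrow> bool"
  assumes domain: "E A B \<Longrightarrow> A \<in> Pfe \<and> B \<in> Pfe"
    and refl: "E {a} {a}"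
    and weaken: "E A B \<Longrightarrow> A' \<in> Pfe \<Longrightarrow> B' \<in> Pfe \<Longrightarrow> E (A \<union> A') (B \<union> B')"
    and cut: "A \<in> Pfe \<Longrightarrow> B \<in> Pfe \<Longrightarrow> E A (B \<union> {c}) \<Longrightarrow> E (A \<union> {c}) B \<Longrightarrow> E A B"

locale regular_entailment = unbounded_entailment E
  for E :: "'a::ordered_ab_group_add set \<Rightarrow> 'a set \<Rightarrow> bool" +
  assumes order: "a \<le> b \<Longrightarrow> E {a} {b}"
    and translate: "E A B \<Longrightarrow> E ((+) x ` A) ((+) x ` B)"
    and regular: "E {x + a, y + b} {y + a, x + b}"

definition forced ::
  "('a::ordered_ab_group_add set \<Rightarrow> 'a \<Rightarrow> bool) \<Rightarrow> 'a list \<Rightarrow> 'a set \<Rightarrow> 'a \<Rightarrow> bool" where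
  "forced R ys = (LEAST S. system_of_ideals S \<and> R \<le> S \<and> (\<forall>y\<in>set ys. S {0} y))"

text \<open>The least element in \<open>forced\<close> exists, since the conditions are stable under intersection
  and the full relation satisfies them.\<close>

lemma forced_least:
  assumes "system_of_ideals R"
  shows "system_of_ideals (forced R ys)"
    and "R \<le> forced R ys"
    and "y \<in> set ys \<Longrightarrow> forced R ys {0} y"
    and "\<lbrakk>system_of_ideals S; R \<le> S; \<forall>y\<in>set ys. S {0} y\<rbrakk> \<Longrightarrow> forced R ys \<le> S"
proof -
  let ?P = "\<lambda>S. system_of_ideals S \<and> R \<le> S \<and> (\<forall>y\<in>set ys. S {0} y)"
  define M where "M = (\<lambda>A b. \<forall>S. ?P S \<longrightarrow> S A b)"
  have full: "?P (\<lambda>A b. A \<in> Pfe)"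
    using system_of_ideals.domain[OF assms]
    by (auto simp: system_of_ideals_def Pfe_def le_fun_def)
  have "system_of_ideals M"
  proof
    fix A b assume "M A b" thus "A \<in> Pfe" using full unfolding M_def by blast
  next
    fix a show "M {a} a" unfolding M_def using system_of_ideals.refl by blast
  next
    fix A A' :: "'a set" and b assume "M A b" "A' \<in> Pfe" thus "M (A \<union> A') b"
      unfolding M_def using system_of_ideals.weaken by blast
  next
    fix A :: "'a set" and b c assume "M A c" "M (A \<union> {c}) b" thus "M A b"
      unfolding M_def using system_of_ideals.cut by blast
  next
    fix a b :: 'a assume "a \<le> b" thus "M {a} b"
      unfolding M_def using system_of_ideals.order by blast
  next
    fix A b x assume "M A b" thus "M ((+) x ` A) (x + b)"
      unfolding M_def using system_of_ideals.translate by blast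
  qed
  moreover have "R \<le> M" "\<forall>y\<in>set ys. M {0} y"
    unfolding M_def le_fun_def by auto
  ultimately have PM: "?P M" by blast
  have least: "M \<le> S" if "?P S" for S using that unfolding M_def le_fun_def by auto
  have eq: "forced R ys = M"
    unfolding forced_def by (rule Least_equality[of ?P, OF PM least])
  show "system_of_ideals (forced R ys)" "R \<le> forced R ys"
    "y \<in> set ys \<Longrightarrow> forced R ys {0} y"
    using PM by (auto simp: eq)
  show "\<lbrakk>system_of_ideals S; R \<le> S; \<forall>y\<in>set ys. S {0} y\<rbrakk> \<Longrightarrow> forced R ys \<le> S"
    using least by (simp add: eq)
qed

text \<open>Elementwise difference, as opposed to the set difference \<open>A - B\<close>.\<close>

definition diff_set :: "'a::ab_group_add set \<Rightarrow> 'a set \<Rightarrow> 'a set" where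
  "diff_set A B = {a - b |a b. a \<in> A \<and> b \<in> B}"

text \<open>The lists \<open>ys\<close> below are exactly the \<open>[\<plusminus>x\<^sub>1, \<dots>, \<plusminus>x\<^sub>m]\<close>, the signs being chosen independently.
  The empty list (\<open>m = 0\<close>) is allowed; it gives the same as \<open>m = 1\<close>, \<open>x\<^sub>1 = 0\<close>.\<close>

definition regularisation ::
  "('a::ordered_ab_group_add set \<Rightarrow> 'a \<Rightarrow> bool) \<Rightarrow> 'a set \<Rightarrow> 'a set \<Rightarrow> bool" where
  "regularisation R A B \<longleftrightarrow> A \<in> Pfe \<and> B \<in> Pfe \<and>
     (\<exists>xs. \<forall>ys. list_all2 (\<lambda>x y. y = x \<or> y = - x) xs ys \<longrightarrow> forced R ys (diff_set A B) 0)"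

end

theory Submission
  imports Defs
begin

text \<open>
  Minimality rests on a merging property of a regular entailment relation \<open>E\<close>: if \<open>E A {b}\<close> holds
  once \<open>0 \<turnstile> x\<close> is forced and also once \<open>0 \<turnstile> - x\<close> is forced, then it holds outright. The explicit
  description of the forced systems turns the two hypotheses into \<open>E A\<^sub>1 {b}\<close> and \<open>E A\<^sub>2 {b}\<close> with
  \<open>A\<^sub>1 \<subseteq> A + \<nat>x\<close> and \<open>A\<^sub>2 \<subseteq> A - \<nat>x\<close>. Cutting on a finite set \<open>F\<close> reduces the claim to the entailments
  \<open>E V (insert b (F - V))\<close> with \<open>A \<subseteq> V \<subseteq> A \<union> F\<close>. If \<open>V\<close> contains \<open>A\<^sub>1\<close> or \<open>A\<^sub>2\<close>, weakening suffices;
  otherwise \<open>V\<close> is left both by a step \<open>x\<close> and by a step \<open>- x\<close>, and regularity applies.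

  That the regularisation admits cut is seen by adding to the list of forced elements all the
  differences of elements in play: for every choice of signs these are then totally preordered,
  and \<open>A - B\<close> may be replaced with the single element \<open>min A - max B\<close>.
\<close>

section \<open>Finite total preorders and elementwise differences\<close>

text \<open>Stated for a bare relation \<open>r\<close> because it serves for
  \<open>R {u} v\<close>, for its converse, and for reverse inclusion of a family of sets.\<close>

lemma finite_total_least:
  assumes "finite A" "A \<noteq> {}"
    and "\<And>u v. u \<in> A \<Longrightarrow> v \<in> A \<Longrightarrow> r u v \<or> r v u"
    and trans: "\<And>u v w. r u v \<Longrightarrow> r v w \<Longrightarrow> r u w"
  shows "\<exists>m\<in>A. \<forall>a\<in>A. r m a"
  using assms(1-3)
proof (induction A rule: finite_ne_induct)
  case (singleton x)
  then show ?case by auto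
next
  case (insert x F)
  then obtain m where m: "m \<in> F" "\<forall>a\<in>F. r m a" by blast
  have "r x m \<or> r m x" "r x x" using insert.prems m(1) by blast+
  then show ?case using m trans by blast
qed

lemma mem_diff_set: "x \<in> diff_set A B \<longleftrightarrow> (\<exists>a\<in>A. \<exists>b\<in>B. x = a - b)"
  by (auto simp: diff_set_def)

lemma diff_set_Pfe:
  assumes "A \<in> Pfe" "B \<in> Pfe"
  shows "diff_set A B \<in> Pfe"
proof -
  have "diff_set A B = (\<lambda>(a, b). a - b) ` (A \<times> B)"
    by (auto simp: diff_set_def)
  with assms show ?thesis by (auto simp: Pfe_def)
qed

section \<open>Systems of ideals\<close>

context system_of_ideals
begin

lemma mono:
  assumes "R A b" "A \<subseteq> A'" "finite A'"
  shows "R A' b"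
proof -
  have "A' \<in> Pfe" using domain[OF assms(1)] assms by (auto simp: Pfe_def)
  with weaken[OF assms(1)] assms(2) show ?thesis by (metis Un_absorb1)
qed

lemma member: "a \<in> A \<Longrightarrow> finite A \<Longrightarrow> R A a"
  using mono[OF refl] by auto

lemma cut_set:
  assumes "R C b" "\<And>c. c \<in> C \<Longrightarrow> R D c" "D \<in> Pfe"
  shows "R D b"
proof -
  have fin: "finite C" "finite D" using domain[OF assms(1)] assms(3) by (auto simp: Pfe_def)
  have "R (D \<union> C) b" using mono[OF assms(1)] fin by auto
  with fin(1) assms(2) show ?thesis
  proof (induction C rule: finite_induct)
    case empty
    then show ?case by simp
  next
    case (insert c C)
    have "R (D \<union> C) c" using mono[OF insert.prems(1)[of c]] fin(2) insert.hyps by auto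
    moreover have "R ((D \<union> C) \<union> {c}) b" using insert.prems(2) by simp
    ultimately have "R (D \<union> C) b" by (rule cut)
    then show ?case using insert by blast
  qed
qed

lemma trans: "R {u} v \<Longrightarrow> R {v} w \<Longrightarrow> R {u} w"
  using cut_set[of "{v}" w "{u}"] by (auto simp: Pfe_def)

lemma translate_single: "R {u} v \<Longrightarrow> R {x + u} (x + v)"
  using translate[of "{u}" v x] by simp

lemma diff_mono:
  assumes "R {a} a'" "R {b'} b"
  shows "R {a - b} (a' - b')"
proof -
  have "R {a - b} (a' - b)"
    using translate_single[OF assms(1), of "- b"] by simp
  moreover have "R {a' - b} (a' - b')"
    using translate_single[OF assms(2), of "a' - b - b'"] by (simp add: algebra_simps)
  ultimately show ?thesis by (rule trans)
qed

text \<open>Read \<open>R {u} v\<close> as "\<open>u\<close> is below \<open>v\<close>". With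
  \<open>a\<close> least in \<open>A\<close> and \<open>b\<close> greatest in \<open>B\<close>,
  every element of \<open>diff_set A B\<close> is above \<open>a - b\<close>, so everything reduces
  to \<open>R {a - b} 0\<close>. If \<open>c\<close> is below \<open>b\<close>, adding
  \<open>c\<close> to \<open>B\<close> changes nothing and \<open>1\<close> suffices; if
  \<open>c\<close> is above \<open>a\<close>, adding it to \<open>A\<close> changes nothing and
  \<open>2\<close> suffices.\<close>

lemma diff_set_cut:
  assumes A: "A \<in> Pfe" and B: "B \<in> Pfe"
    and total: "\<And>u v. u \<in> A \<union> B \<union> {c} \<Longrightarrow> v \<in> A \<union> B \<union> {c} \<Longrightarrow> R {u} v \<or> R {v} u"
    and 1: "R (diff_set A (B \<union> {c})) 0" and 2: "R (diff_set (A \<union> {c}) B) 0"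
  shows "R (diff_set A B) 0"
proof -
  have "\<exists>a\<in>A. \<forall>u\<in>A. R {a} u"
  proof (rule finite_total_least)
    show "R {u} w" if "R {u} v" "R {v} w" for u v w using trans that .
  qed (use A total in \<open>simp_all add: Pfe_def\<close>)
  then obtain a where a: "a \<in> A" "\<forall>u\<in>A. R {a} u" by blast
  have "\<exists>b\<in>B. \<forall>v\<in>B. R {v} b"
  proof (rule finite_total_least)
    show "R {w} u" if "R {v} u" "R {w} v" for u v w using trans that(2,1) .
  qed (use B total in \<open>simp_all add: Pfe_def\<close>)
  then obtain b where b: "b \<in> B" "\<forall>v\<in>B. R {v} b" by blast
  have le_c: "R {a - b} 0" if "R {a} c"
    by (rule cut_set[OF 2]) (use a b that diff_mono in \<open>auto simp: mem_diff_set Pfe_def\<close>)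
  have c_le: "R {a - b} 0" if "R {c} b"
    by (rule cut_set[OF 1]) (use a b that diff_mono in \<open>auto simp: mem_diff_set Pfe_def\<close>)
  have "R {a - b} 0"
  proof (cases "R {c} b")
    case False
    \<comment> \<open>Now \<open>c\<close> is greatest in \<open>B \<union> {c}\<close>, so
      \<open>1\<close> yields \<open>R {a - c} 0\<close>. Translated by \<open>c\<close>, this puts
      \<open>c\<close> above \<open>a\<close>.\<close>
    with total b have "R {b} c" by blast
    then have "\<forall>v\<in>B \<union> {c}. R {v} c" using b trans refl by blast
    then have "R {a - c} 0"
      by (intro cut_set[OF 1]) (use a diff_mono in \<open>auto simp: mem_diff_set Pfe_def\<close>)
    then have "R {a} c" using translate_single[of "a - c" 0 c] by simp
    then show ?thesis by (rule le_c)
  qed (rule c_le)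
  moreover have "a - b \<in> diff_set A B" using a b by (auto simp: mem_diff_set)
  ultimately show ?thesis
    using mono diff_set_Pfe[OF A B] by (auto simp: Pfe_def)
qed

end

section \<open>Forced systems\<close>

text \<open>The submonoid generated by \<open>Y\<close>. Building it one generator at a time lets
  inductions follow a path of single steps.\<close>

inductive_set additive_span :: "'a::ab_group_add set \<Rightarrow> 'a set" for Y where
  zero: "0 \<in> additive_span Y"
| step: "y \<in> Y \<Longrightarrow> m \<in> additive_span Y \<Longrightarrow> y + m \<in> additive_span Y"

lemma additive_span_add:
  "m \<in> additive_span Y \<Longrightarrow> n \<in> additive_span Y \<Longrightarrow> m + n \<in> additive_span Y"
  by (induction m rule: additive_span.induct) (auto simp: add.assoc intro: additive_span.intros)

definition sumset :: "'a::ab_group_add set \<Rightarrow> 'a set \<Rightarrow> 'a set" where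
  "sumset A M = {a + m |a m. a \<in> A \<and> m \<in> M}"

lemma subset_sumset_span: "A \<subseteq> sumset A (additive_span Y)"
  by (force simp: sumset_def intro: additive_span.zero)

text \<open>The explicit form of \<open>forced R ys\<close> for \<open>Y = set ys\<close>: forcing
  \<open>0\<close> to entail each \<open>y\<close> makes \<open>a\<close> entail every
  \<open>a + m\<close> with \<open>m\<close> in the span.\<close>

definition adjoin ::
  "('a::ab_group_add set \<Rightarrow> 'a \<Rightarrow> bool) \<Rightarrow> 'a set \<Rightarrow> 'a set \<Rightarrow> 'a \<Rightarrow> bool" where
  "adjoin R Y A b \<longleftrightarrow> A \<in> Pfe \<and> (\<exists>A'. A' \<subseteq> sumset A (additive_span Y) \<and> R A' b)"

lemma adjoinI: "A \<in> Pfe \<Longrightarrow> A' \<subseteq> sumset A (additive_span Y) \<Longrightarrow> R A' b \<Longrightarrow> adjoin R Y A b"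
  by (auto simp: adjoin_def)

lemma (in system_of_ideals) adjoin_extends: "R \<le> adjoin R Y"
proof (intro predicate2I)
  fix A b assume "R A b"
  then show "adjoin R Y A b" using domain subset_sumset_span by (intro adjoinI[where R = R])
qed

lemma (in system_of_ideals) adjoin_system: "system_of_ideals (adjoin R Y)"
proof
  show "A \<in> Pfe" if "adjoin R Y A b" for A b
    using that by (simp add: adjoin_def)
next
  show "adjoin R Y {a} a" for a
    by (rule predicate2D[OF adjoin_extends refl])
next
  fix A A' :: "'a set" and b assume "adjoin R Y A b" "A' \<in> Pfe"
  then obtain C where C: "A \<in> Pfe" "C \<subseteq> sumset A (additive_span Y)" "R C b"
    by (auto simp: adjoin_def)
  then have "C \<subseteq> sumset (A \<union> A') (additive_span Y)" unfolding sumset_def by blast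
  moreover have "A \<union> A' \<in> Pfe" using C(1) \<open>A' \<in> Pfe\<close> by (auto simp: Pfe_def)
  ultimately show "adjoin R Y (A \<union> A') b" using C(3) by (intro adjoinI[where R = R])
next
  fix A c b assume 1: "adjoin R Y A c" and 2: "adjoin R Y (A \<union> {c}) b"
  let ?S = "sumset A (additive_span Y)"
  obtain A' where A': "A \<in> Pfe" "A' \<subseteq> ?S" "R A' c" using 1 by (auto simp: adjoin_def)
  obtain C where C: "C \<subseteq> sumset (A \<union> {c}) (additive_span Y)" "R C b"
    using 2 by (auto simp: adjoin_def)
  \<comment> \<open>This is the heart of cut: an element of \<open>C\<close> either is already in
    \<open>?S\<close> or equals \<open>c + m\<close>, and then the derivation of \<open>c\<close>
    from \<open>A'\<close>, translated by \<open>m\<close>, stays inside \<open>?S\<close> since the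
    span is closed under addition.\<close>
  have "\<exists>D. D \<subseteq> ?S \<and> R D e" if "e \<in> C" for e
  proof -
    consider "e \<in> ?S" | m where "m \<in> additive_span Y" "e = c + m"
      using \<open>e \<in> C\<close> C(1) unfolding sumset_def by blast
    then show ?thesis
    proof cases
      case 1
      then show ?thesis using refl by (intro exI[of _ "{e}"]) auto
    next
      case 2
      have "R ((+) m ` A') e" using translate[OF A'(3), of m] 2 by (simp add: add.commute)
      moreover have "(+) m ` A' \<subseteq> ?S"
      proof
        fix z assume "z \<in> (+) m ` A'"
        then obtain a n where "a \<in> A" "n \<in> additive_span Y" "z = m + (a + n)"
          using A'(2) by (auto simp: sumset_def)
        moreover from this have "z = a + (m + n)" by (simp add: algebra_simps)
        ultimately show "z \<in> ?S"
          using additive_span_add[OF 2(1)] by (auto simp: sumset_def)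
      qed
      ultimately show ?thesis by blast
    qed
  qed
  then obtain D where D: "\<And>e. e \<in> C \<Longrightarrow> D e \<subseteq> ?S \<and> R (D e) e" by metis
  have C': "finite C" "C \<noteq> {}" using domain[OF C(2)] by (auto simp: Pfe_def)
  have D': "finite (D e)" "D e \<noteq> {}" if "e \<in> C" for e
    using domain D that by (auto simp: Pfe_def)
  have fin: "finite (\<Union>e\<in>C. D e)" using C' D' by blast
  have "R (\<Union>e\<in>C. D e) b"
  proof (rule cut_set[OF C(2)])
    show "R (\<Union>e\<in>C. D e) e" if "e \<in> C" for e
      using mono[of "D e" e] D fin that by blast
    show "(\<Union>e\<in>C. D e) \<in> Pfe" using fin C' D' by (auto simp: Pfe_def)
  qed
  moreover have "(\<Union>e\<in>C. D e) \<subseteq> ?S" using D by blast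
  ultimately show "adjoin R Y A b" using A'(1) by (intro adjoinI[where R = R])
next
  show "adjoin R Y {a} b" if "a \<le> b" for a b
    by (rule predicate2D[OF adjoin_extends order[OF that]])
next
  fix A b x assume "adjoin R Y A b"
  then obtain C where C: "A \<in> Pfe" "C \<subseteq> sumset A (additive_span Y)" "R C b"
    by (auto simp: adjoin_def)
  have "(+) x ` C \<subseteq> sumset ((+) x ` A) (additive_span Y)"
  proof
    fix z assume "z \<in> (+) x ` C"
    then obtain a m where "a \<in> A" "m \<in> additive_span Y" "z = x + (a + m)"
      using C(2) unfolding sumset_def by blast
    then have "x + a \<in> (+) x ` A" "z = (x + a) + m" by (simp_all add: add.assoc)
    with \<open>m \<in> additive_span Y\<close> show "z \<in> sumset ((+) x ` A) (additive_span Y)"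
      unfolding sumset_def by blast
  qed
  moreover have "(+) x ` A \<in> Pfe" using C(1) by (auto simp: Pfe_def)
  ultimately show "adjoin R Y ((+) x ` A) (x + b)"
    using translate[OF C(3)] by (intro adjoinI[where R = R])
qed

lemma (in system_of_ideals) adjoin_generator:
  assumes "y \<in> Y" shows "adjoin R Y {0} y"
proof (rule adjoinI[where R = R])
  have "y + 0 \<in> additive_span Y" using assms by (intro additive_span.intros)
  then show "{y} \<subseteq> sumset {0} (additive_span Y)" by (auto simp: sumset_def)
qed (auto simp: Pfe_def refl)

lemma (in system_of_ideals) forced_le_adjoin: "forced R ys \<le> adjoin R (set ys)"
  by (rule forced_least(4)[OF system_of_ideals_axioms adjoin_system adjoin_extends])
    (simp add: adjoin_generator)

text \<open>In \<open>S\<close>, chaining generators shows that \<open>0\<close> entails each member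
  of the span. Translation by \<open>a\<close> gives each \<open>a + m\<close>, after which
  \<open>C\<close> can be cut away.\<close>

lemma system_adjoin_le:
  assumes "system_of_ideals S" "R \<le> S" "\<forall>y\<in>Y. S {0} y"
  shows "adjoin R Y \<le> S"
proof (intro predicate2I)
  interpret S: system_of_ideals S by fact
  fix A b assume "adjoin R Y A b"
  then obtain C where C: "A \<in> Pfe" "C \<subseteq> sumset A (additive_span Y)" "R C b"
    by (auto simp: adjoin_def)
  have pos: "S {0} m" if "m \<in> additive_span Y" for m
    using that
  proof induction
    case zero
    then show ?case by (rule S.refl)
  next
    case (step y m)
    have "S {0} y" using assms(3) step.hyps by blast
    moreover have "S {y} (y + m)" using S.translate_single[OF step.IH, of y] by simp
    ultimately show ?case by (rule S.trans)
  qed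
  have "S A c" if "c \<in> C" for c
  proof -
    obtain a m where am: "a \<in> A" "m \<in> additive_span Y" "c = a + m"
      using C(2) \<open>c \<in> C\<close> unfolding sumset_def by blast
    have "S {a} c" using S.translate_single[OF pos[OF am(2)], of a] am(3) by simp
    then show ?thesis using S.mono am(1) C(1) by (auto simp: Pfe_def)
  qed
  moreover have "S C b" by (rule predicate2D[OF assms(2) C(3)])
  ultimately show "S A b" using C(1) by (intro S.cut_set[of C b A])
qed

lemma forced_eq_adjoin:
  assumes "system_of_ideals R"
  shows "forced R ys = adjoin R (set ys)"
proof (rule antisym)
  show "forced R ys \<le> adjoin R (set ys)"
    using system_of_ideals.forced_le_adjoin[OF assms] .
  show "adjoin R (set ys) \<le> forced R ys"
    using forced_least(3)[OF assms]
    by (intro system_adjoin_le forced_least(1,2)[OF assms]) simp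
qed

section \<open>Comparing, iterating and merging forced systems\<close>

lemma forced_mono:
  assumes R: "system_of_ideals R" and S: "system_of_ideals S"
    and "R \<le> S" "set ys \<subseteq> set zs"
  shows "forced R ys \<le> forced S zs"
proof (rule forced_least(4)[OF R forced_least(1)[OF S]])
  show "R \<le> forced S zs" using assms(3) forced_least(2)[OF S] by (rule order_trans)
  show "\<forall>y\<in>set ys. forced S zs {0} y" using forced_least(3)[OF S] assms(4) by blast
qed

text \<open>Forcing the head first and the tail afterwards meets all conditions on the left side,
  which is least. This allows signs to be removed one at a time.\<close>

lemma forced_Cons:
  assumes R: "system_of_ideals R"
  shows "forced R (y # ys) \<le> forced (forced R [y]) ys"
proof (rule forced_least(4)[OF R])
  let ?S = "forced R [y]"
  have S: "system_of_ideals ?S" by (rule forced_least(1)[OF R])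
  show "system_of_ideals (forced ?S ys)" by (rule forced_least(1)[OF S])
  show "R \<le> forced ?S ys" using forced_least(2)[OF R] forced_least(2)[OF S] by (rule order_trans)
  have "?S {0} y" using forced_least(3)[OF R] by simp
  then have "forced ?S ys {0} y" using forced_least(2)[OF S] by blast
  then show "\<forall>z\<in>set (y # ys). forced ?S ys {0} z" using forced_least(3)[OF S] by simp
qed

text \<open>The explicit description gives witnesses \<open>C\<close> and \<open>D\<close> inside
  the same \<open>sumset\<close>. From \<open>C \<union> D\<close> both \<open>S\<close> and
  \<open>T\<close> derive \<open>b\<close>, so \<open>merge\<close> applies before anything is
  forced.\<close>

lemma forced_inf:
  assumes R: "system_of_ideals R" and S: "system_of_ideals S" and T: "system_of_ideals T"
    and merge: "\<And>A b. S A b \<Longrightarrow> T A b \<Longrightarrow> R A b"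
    and "forced S ys A b" "forced T ys A b"
  shows "forced R ys A b"
proof -
  interpret S: system_of_ideals S by fact
  interpret T: system_of_ideals T by fact
  obtain C D where A: "A \<in> Pfe"
    and C: "C \<subseteq> sumset A (additive_span (set ys))" "S C b"
    and D: "D \<subseteq> sumset A (additive_span (set ys))" "T D b"
    using assms(5,6) by (auto simp: forced_eq_adjoin[OF S] forced_eq_adjoin[OF T] adjoin_def)
  have "finite C" "finite D" using S.domain[OF C(2)] T.domain[OF D(2)] by (auto simp: Pfe_def)
  then have "R (C \<union> D) b" using merge S.mono[OF C(2)] T.mono[OF D(2)] by auto
  then show ?thesis
    using A C(1) D(1) by (auto simp: forced_eq_adjoin[OF R] intro: adjoinI[where R = R, of _ "C \<union> D"])
qed

lemma forced_all_signs:
  assumes R: "system_of_ideals R"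
    and merge: "\<And>x A b. forced R [x] A b \<Longrightarrow> forced R [- x] A b \<Longrightarrow> R A b"
    and "\<forall>ys. list_all2 (\<lambda>x y. y = x \<or> y = - x) xs ys \<longrightarrow> forced R ys A b"
  shows "R A b"
  using assms(3)
proof (induction xs)
  case Nil
  then have "forced R [] A b" by simp
  moreover have "forced R [] \<le> R" using forced_least(4)[OF R R] by simp
  ultimately show ?case by blast
next
  case (Cons x xs)
  \<comment> \<open>With the signs \<open>ys\<close> of the tail fixed, the two signs of the head
    are merged underneath them.\<close>
  have "forced R ys A b" if "list_all2 (\<lambda>x y. y = x \<or> y = - x) xs ys" for ys
  proof (rule forced_inf[OF R forced_least(1)[OF R] forced_least(1)[OF R] merge])
    have "forced R (x # ys) A b" "forced R (- x # ys) A b" using Cons.prems that by simp_all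
    then show "forced (forced R [x]) ys A b" "forced (forced R [- x]) ys A b"
      using forced_Cons[OF R] by blast+
  qed
  then show ?case using Cons.IH by blast
qed

section \<open>Regular entailment relations\<close>

lemma (in unbounded_entailment) mono:
  assumes "E A B" "A \<subseteq> A'" "B \<subseteq> B'" "finite A'" "finite B'"
  shows "E A' B'"
proof -
  have "A' \<in> Pfe" "B' \<in> Pfe" using domain[OF assms(1)] assms by (auto simp: Pfe_def)
  from weaken[OF assms(1) this] assms(2,3) show ?thesis by (metis Un_absorb1)
qed

text \<open>Iterated cut: each element of \<open>F\<close> is sent to the left or to the right, and
  \<open>U\<close> records those sent to the left.\<close>

lemma (in unbounded_entailment) cut_subsets:
  assumes "finite F" "A \<in> Pfe" "B \<in> Pfe"
    and "\<And>U. U \<subseteq> F \<Longrightarrow> E (A \<union> U) (B \<union> (F - U))"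
  shows "E A B"
  using assms
proof (induction F arbitrary: A B rule: finite_induct)
  case empty
  then show ?case using empty(3)[of "{}"] by simp
next
  case (insert f F)
  show ?case
  proof (rule cut[of _ _ f])
    show "E A (B \<union> {f})"
    proof (rule insert.IH)
      fix U assume U: "U \<subseteq> F"
      then have "insert f F - U = insert f (F - U)" using insert.hyps by auto
      then show "E (A \<union> U) (B \<union> {f} \<union> (F - U))"
        using insert.prems(3)[of U] U by auto
    qed (use insert.prems in \<open>auto simp: Pfe_def\<close>)
    show "E (A \<union> {f}) B"
    proof (rule insert.IH)
      fix U assume U: "U \<subseteq> F"
      have "insert f F - insert f U = F - U" using insert.hyps by auto
      then show "E (A \<union> {f} \<union> U) (B \<union> (F - U))"
        using insert.prems(3)[of "insert f U"] U by auto
    qed (use insert.prems in \<open>auto simp: Pfe_def\<close>)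
  qed (use insert.prems in auto)
qed

text \<open>Go from a point of \<open>A\<close> to \<open>e\<close> by steps \<open>x\<close>. A set
  \<open>V\<close> containing the start but not the end is left at some step, and \<open>F\<close>
  collects the points reached. It is chosen before \<open>V\<close>, so that one can cut on
  it.\<close>

lemma span_step_exit:
  assumes "e \<in> sumset A (additive_span {x})"
  shows "\<exists>F. finite F \<and> (\<forall>V. A \<subseteq> V \<longrightarrow> e \<in> V \<or> (\<exists>v\<in>V. x + v \<in> F - V))"
proof -
  obtain a m where e: "e = a + m" "a \<in> A" "m \<in> additive_span {x}"
    using assms by (auto simp: sumset_def)
  have "\<exists>F. finite F \<and> (\<forall>V. A \<subseteq> V \<longrightarrow> a + m \<in> V \<or> (\<exists>v\<in>V. x + v \<in> F - V))"
    using e(3)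
  proof induction
    case zero
    then show ?case using e(2) by auto
  next
    case (step y m)
    then obtain F where F: "finite F"
      "\<And>V. A \<subseteq> V \<Longrightarrow> a + m \<in> V \<or> (\<exists>v\<in>V. x + v \<in> F - V)" by auto
    have eq: "a + (y + m) = x + (a + m)" using step.hyps by (simp add: algebra_simps)
    \<comment> \<open>The path grows by one point: if no earlier exit exists then
      \<open>a + m \<in> V\<close>, and the new point is either in \<open>V\<close> or itself the
      exit.\<close>
    show ?case
    proof (intro exI[of _ "insert (x + (a + m)) F"] conjI allI impI)
      fix V assume "A \<subseteq> V"
      from F(2)[OF this]
      show "a + (y + m) \<in> V \<or> (\<exists>v\<in>V. x + v \<in> insert (x + (a + m)) F - V)"
        unfolding eq by blast
    qed (use F(1) in simp)
  qed
  then show ?thesis using e(1) by simp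
qed

lemma span_step_exit_set:
  assumes "finite C" "C \<subseteq> sumset A (additive_span {x})"
  shows "\<exists>F. finite F \<and> (\<forall>V. A \<subseteq> V \<longrightarrow> C \<subseteq> V \<or> (\<exists>v\<in>V. x + v \<in> F - V))"
proof -
  have "\<forall>e\<in>C. \<exists>F. finite F \<and> (\<forall>V. A \<subseteq> V \<longrightarrow> e \<in> V \<or> (\<exists>v\<in>V. x + v \<in> F - V))"
    using span_step_exit[OF subsetD[OF assms(2)]] by (rule ballI)
  then obtain F where F: "\<forall>e\<in>C. finite (F e) \<and>
      (\<forall>V. A \<subseteq> V \<longrightarrow> e \<in> V \<or> (\<exists>v\<in>V. x + v \<in> F e - V))"
    by (rule bchoice[THEN exE])
  show ?thesis
  proof (intro exI[of _ "\<Union>e\<in>C. F e"] conjI allI impI)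
    fix V assume "A \<subseteq> V"
    with F have "e \<in> V \<or> (\<exists>v\<in>V. x + v \<in> F e - V)" if "e \<in> C" for e
      using that by simp
    then show "C \<subseteq> V \<or> (\<exists>v\<in>V. x + v \<in> (\<Union>e\<in>C. F e) - V)" by blast
  qed (use F assms(1) in simp)
qed

context regular_entailment
begin

lemma restriction_system: "system_of_ideals (\<lambda>A b. E A {b})"
proof
  fix A c b assume *: "E A {c}" "E (A \<union> {c}) {b}"
  have "E A ({b} \<union> {c})" using mono[OF *(1)] domain[OF *(1)] by (auto simp: Pfe_def)
  then show "E A {b}" using cut *(2) domain[OF *(1)] by (auto simp: Pfe_def)
next
  fix A A' :: "'a set" and b assume "E A {b}" "A' \<in> Pfe"
  then show "E (A \<union> A') {b}" using mono domain by (auto simp: Pfe_def)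
next
  fix A b x assume "E A {b}"
  then show "E ((+) x ` A) {x + b}" using translate[of A "{b}" x] by simp
qed (use domain refl order in auto)

lemma restriction_merge:
  assumes "forced (\<lambda>A b. E A {b}) [x] A b" "forced (\<lambda>A b. E A {b}) [- x] A b"
  shows "E A {b}"
proof -
  note eq = forced_eq_adjoin[OF restriction_system]
  obtain C D where A: "A \<in> Pfe"
    and C: "C \<subseteq> sumset A (additive_span {x})" "E C {b}"
    and D: "D \<subseteq> sumset A (additive_span {- x})" "E D {b}"
    using assms by (auto simp: eq adjoin_def)
  have fin: "finite A" "finite C" "finite D"
    using A domain[OF C(2)] domain[OF D(2)] by (auto simp: Pfe_def)
  obtain F where F: "finite F" "\<And>V. A \<subseteq> V \<Longrightarrow> C \<subseteq> V \<or> (\<exists>v\<in>V. x + v \<in> F - V)"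
    using span_step_exit_set[OF fin(2) C(1)] by blast
  obtain H where H: "finite H" "\<And>V. A \<subseteq> V \<Longrightarrow> D \<subseteq> V \<or> (\<exists>v\<in>V. - x + v \<in> H - V)"
    using span_step_exit_set[OF fin(3) D(1)] by blast
  show ?thesis
  proof (rule cut_subsets[of "F \<union> H"])
    fix U assume U: "U \<subseteq> F \<union> H"
    let ?V = "A \<union> U" and ?W = "{b} \<union> (F \<union> H - U)"
    have fVW: "finite ?V" "finite ?W" using U fin F(1) H(1) finite_subset by auto
    consider "C \<subseteq> ?V" | "D \<subseteq> ?V"
      | v w where "v \<in> ?V" "x + v \<in> F - ?V" "w \<in> ?V" "- x + w \<in> H - ?V"
      using F(2)[of ?V] H(2)[of ?V] by blast
    then show "E ?V ?W"
    proof cases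
      case 1
      then show ?thesis using mono[OF C(2)] fVW by auto
    next
      case 2
      then show ?thesis using mono[OF D(2)] fVW by auto
    next
      case 3
      \<comment> \<open>The step \<open>x\<close> is moved from \<open>w\<close> to
        \<open>v\<close>. Both points on the right are outside \<open>?V\<close> but in
        \<open>F \<union> H\<close>, hence in \<open>?W\<close>.\<close>
      have "E {v, w} {x + v, - x + w}" using regular[of 0 v x "- x + w"] by simp
      then show ?thesis using 3 by (elim mono) (use fVW in auto)
    qed
  qed (use A F(1) H(1) in \<open>auto simp: Pfe_def\<close>)
qed

text \<open>Regularity makes the sets \<open>{d \<in> A - B. d + b \<in> V}\<close>, for \<open>b \<in> B\<close>, a chain; the largest of
  them is all of \<open>A - B\<close>, so that translating the hypothesis by the corresponding \<open>b\<close> suffices.\<close>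

lemma of_diff_set:
  assumes A: "A \<in> Pfe" and B: "B \<in> Pfe" and "E (diff_set A B) {0}"
  shows "E A B"
proof -
  let ?D = "diff_set A B"
  \<comment> \<open>Cutting on all sums \<open>d + b\<close> ensures that each of them is in
    \<open>?V\<close> or in \<open>?W\<close>.\<close>
  define F where "F = (\<lambda>(d, b). d + b) ` (?D \<times> B)"
  have F: "d + b \<in> F" if "d \<in> ?D" "b \<in> B" for d b using that by (auto simp: F_def)
  have "finite F" using diff_set_Pfe[OF A B] B by (auto simp: F_def Pfe_def)
  then show ?thesis
  proof (rule cut_subsets[OF _ A B])
    fix U assume U: "U \<subseteq> F"
    let ?V = "A \<union> U" and ?W = "B \<union> (F - U)"
    have fVW: "finite ?V" "finite ?W"
      using U A B \<open>finite F\<close> finite_subset by (auto simp: Pfe_def)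
    define P where "P b = {d \<in> ?D. d + b \<in> ?V}" for b
    show "E ?V ?W"
    proof (cases "\<forall>b\<in>B. \<forall>c\<in>B. P b \<subseteq> P c \<or> P c \<subseteq> P b")
      case True
      then obtain b where b: "b \<in> B" "\<forall>c\<in>B. P c \<subseteq> P b"
        using finite_total_least[of B "\<lambda>u v. P v \<subseteq> P u"] B by (auto simp: Pfe_def)
      have "(+) b ` ?D \<subseteq> ?V"
      proof
        fix z assume "z \<in> (+) b ` ?D"
        then obtain a c where ac: "a \<in> A" "c \<in> B" "z = b + (a - c)"
          by (auto simp: mem_diff_set)
        then have "a - c \<in> P c" by (auto simp: P_def mem_diff_set)
        then have "a - c \<in> P b" using b ac by blast
        then show "z \<in> ?V" using ac by (simp add: P_def add.commute)
      qed
      moreover have "E ((+) b ` ?D) {b}" using translate[OF assms(3), of b] by simp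
      ultimately show ?thesis using b(1) by (elim mono) (use fVW in auto)
    next
      case False
      then obtain b c d e where *: "b \<in> B" "c \<in> B" "d \<in> P b" "d \<notin> P c" "e \<in> P c" "e \<notin> P b"
        by blast
      \<comment> \<open>Incomparable \<open>P b\<close> and \<open>P c\<close> give two sums in
        \<open>?V\<close> whose exchanged sums are outside \<open>?V\<close>, hence in
        \<open>?W\<close>.\<close>
      have "E {d + b, e + c} {e + b, d + c}" by (rule regular)
      moreover have "{d + b, e + c} \<subseteq> ?V" using * by (auto simp: P_def)
      moreover have "{e + b, d + c} \<subseteq> ?W" using * F by (auto simp: P_def)
      ultimately show ?thesis by (elim mono) (use fVW in auto)
    qed
  qed
qed

text \<open>By monotonicity the signed derivations hold over the restriction of \<open>E\<close>;
  merging removes the signs, and \<open>of_diff_set\<close> separates \<open>A\<close> from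
  \<open>B\<close> again.\<close>

lemma regularisation_le:
  assumes R: "system_of_ideals R" and le: "\<And>A b. R A b \<Longrightarrow> E A {b}"
  shows "regularisation R \<le> E"
proof (intro predicate2I)
  fix A B assume "regularisation R A B"
  then obtain xs where A: "A \<in> Pfe" and B: "B \<in> Pfe"
    and xs: "\<forall>ys. list_all2 (\<lambda>x y. y = x \<or> y = - x) xs ys \<longrightarrow> forced R ys (diff_set A B) 0"
    by (auto simp: regularisation_def)
  have "forced R ys \<le> forced (\<lambda>A b. E A {b}) ys" for ys
    using le by (intro forced_mono[OF R restriction_system]) auto
  then have *: "\<forall>ys. list_all2 (\<lambda>x y. y = x \<or> y = - x) xs ys \<longrightarrow>
      forced (\<lambda>A b. E A {b}) ys (diff_set A B) 0" using xs by blast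
  have "E (diff_set A B) {0}"
    by (rule forced_all_signs[where R = "\<lambda>A b. E A {b}", OF restriction_system _ *])
      (rule restriction_merge)
  then show "E A B" using of_diff_set A B by blast
qed

end

section \<open>The regularisation\<close>

lemma signed_member:
  assumes "list_all2 (\<lambda>x y. y = x \<or> y = - x) xs ys" "x \<in> set xs"
  shows "x \<in> set ys \<or> - x \<in> set ys"
  using assms by (induction rule: list_all2_induct) auto

context system_of_ideals
begin

lemma regularisation_extends:
  assumes "A \<in> Pfe" "B \<in> Pfe" "R (diff_set A B) 0"
  shows "regularisation R A B"
proof -
  have "forced R ys (diff_set A B) 0" for ys
    using forced_least(2)[OF system_of_ideals_axioms] assms(3) by blast
  then show ?thesis using assms by (auto simp: regularisation_def)
qed

lemma regularisation_cut:
  assumes A: "A \<in> Pfe" and B: "B \<in> Pfe"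
    and "regularisation R A (B \<union> {c})" "regularisation R (A \<union> {c}) B"
  shows "regularisation R A B"
proof -
  let ?signs = "list_all2 (\<lambda>x y :: 'a. y = x \<or> y = - x)"
  let ?X = "A \<union> B \<union> {c}"
  obtain xs where xs: "\<And>ys. ?signs xs ys \<Longrightarrow> forced R ys (diff_set A (B \<union> {c})) 0"
    using assms(3) unfolding regularisation_def by blast
  obtain xs' where xs': "\<And>ys. ?signs xs' ys \<Longrightarrow> forced R ys (diff_set (A \<union> {c}) B) 0"
    using assms(4) unfolding regularisation_def by blast
  have X: "?X \<in> Pfe" using A B by (auto simp: Pfe_def)
  have "finite (diff_set ?X ?X)" using diff_set_Pfe[OF X X] unfolding Pfe_def by blast
  then obtain zs where zs: "set zs = diff_set ?X ?X" using finite_list by blast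
  \<comment> \<open>The parts \<open>xs\<close> and \<open>xs'\<close> carry over the two
    hypotheses. Through \<open>zs\<close>, the sign chosen for \<open>v - u\<close> decides which of
    \<open>u\<close> and \<open>v\<close> entails the other.\<close>
  have "forced R ys (diff_set A B) 0" if signs: "?signs (xs @ xs' @ zs) ys" for ys
  proof -
    obtain us vs ws where ys: "ys = us @ vs @ ws" "?signs xs us" "?signs xs' vs" "?signs zs ws"
      using signs by (auto simp: list_all2_append1)
    note forcedR = forced_least[OF system_of_ideals_axioms]
    interpret F: system_of_ideals "forced R ys" by (rule forcedR(1))
    have weaker: "forced R us' \<le> forced R ys" if "set us' \<subseteq> set ys" for us'
      using forced_mono[OF system_of_ideals_axioms system_of_ideals_axioms order_refl that] .
    have total: "forced R ys {u} v \<or> forced R ys {v} u" if "u \<in> ?X" "v \<in> ?X" for u v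
    proof -
      have "v - u \<in> set zs" unfolding zs mem_diff_set using that by blast
      with ys(4) have "v - u \<in> set ws \<or> - (v - u) \<in> set ws"
        by (rule signed_member)
      then have "forced R ys {0} (v - u) \<or> forced R ys {0} (u - v)"
        using forcedR(3)[of _ ys] ys(1) by auto
      then show ?thesis
        using F.translate_single[of 0 "v - u" u] F.translate_single[of 0 "u - v" v] by auto
    qed
    show ?thesis
    proof (rule F.diff_set_cut[OF A B total])
      show "forced R ys (diff_set A (B \<union> {c})) 0"
        using xs[OF ys(2)] weaker[of us] ys(1) by auto
      show "forced R ys (diff_set (A \<union> {c}) B) 0"
        using xs'[OF ys(3)] weaker[of vs] ys(1) by auto
    qed
  qed
  then show ?thesis using A B unfolding regularisation_def by blast
qed

text \<open>The single witness \<open>x - y\<close> suffices. Both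
  \<open>x - y = (x + a) - (y + a)\<close> and \<open>y - x = (y + b) - (x + b)\<close> are in
  \<open>?D\<close>, and forcing \<open>0\<close> to entail \<open>z\<close> makes
  \<open>- z\<close> entail \<open>0\<close>.\<close>

lemma regularisation_regular: "regularisation R {x + a, y + b} {y + a, x + b}"
proof -
  let ?D = "diff_set {x + a, y + b} {y + a, x + b}"
  have Pfe: "{x + a, y + b} \<in> Pfe" "{y + a, x + b} \<in> Pfe" by (auto simp: Pfe_def)
  have "x - y \<in> ?D" "y - x \<in> ?D" by (auto simp: mem_diff_set)
  have "forced R [z] ?D 0" if "- z \<in> ?D" for z
  proof -
    interpret F: system_of_ideals "forced R [z]"
      by (rule forced_least(1)[OF system_of_ideals_axioms])
    have "forced R [z] {0} z" using forced_least(3)[OF system_of_ideals_axioms] by simp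
    from F.translate_single[OF this, of "- z"] have "forced R [z] {- z} 0" by simp
    then show ?thesis using F.mono that diff_set_Pfe[OF Pfe] by (auto simp: Pfe_def)
  qed
  from this[of "x - y"] this[of "y - x"] \<open>x - y \<in> ?D\<close> \<open>y - x \<in> ?D\<close>
  have "\<forall>ys. list_all2 (\<lambda>x y. y = x \<or> y = - x) [x - y] ys \<longrightarrow> forced R ys ?D 0"
    by (auto simp: list_all2_Cons1)
  then show ?thesis using Pfe unfolding regularisation_def by blast
qed

lemma regularisation_regular_entailment: "regular_entailment (regularisation R)"
proof
  show "A \<in> Pfe \<and> B \<in> Pfe" if "regularisation R A B" for A B
    using that by (simp add: regularisation_def)
next
  show "regularisation R {a} {a}" for a
    using refl[of 0] by (intro regularisation_extends) (auto simp: Pfe_def diff_set_def)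
next
  fix A B A' B' :: "'a set" assume *: "regularisation R A B" and A'B': "A' \<in> Pfe" "B' \<in> Pfe"
  have Pfe: "A \<union> A' \<in> Pfe" "B \<union> B' \<in> Pfe"
    using * A'B' by (auto simp: regularisation_def Pfe_def)
  have "diff_set A B \<subseteq> diff_set (A \<union> A') (B \<union> B')" unfolding diff_set_def by blast
  \<comment> \<open>Larger sets have a larger difference set, so the same witnesses
    \<open>xs\<close> serve.\<close>
  then have "forced R ys (diff_set (A \<union> A') (B \<union> B')) 0" if "forced R ys (diff_set A B) 0" for ys
    using system_of_ideals.mono[OF forced_least(1)[OF system_of_ideals_axioms] that]
      diff_set_Pfe[OF Pfe] by (simp add: Pfe_def)
  then show "regularisation R (A \<union> A') (B \<union> B')"
    using * Pfe unfolding regularisation_def by blast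
next
  show "regularisation R {a} {b}" if "a \<le> b" for a b
    using order[of "a - b" 0] that
    by (intro regularisation_extends) (auto simp: Pfe_def diff_set_def)
next
  fix A B x assume "regularisation R A B"
  moreover have "diff_set ((+) x ` A) ((+) x ` B) = diff_set A B"
    by (auto simp: mem_diff_set)
  ultimately show "regularisation R ((+) x ` A) ((+) x ` B)"
    by (auto simp: regularisation_def Pfe_def)
qed (fact regularisation_cut regularisation_regular)+

lemma regularisation_coarser:
  assumes "R A b" shows "regularisation R A {b}"
proof (rule regularisation_extends)
  have "diff_set A {b} = (+) (- b) ` A" by (simp add: set_eq_iff mem_diff_set image_iff)
  then show "R (diff_set A {b}) 0" using translate[OF assms, of "- b"] by simp
qed (use domain[OF assms] in \<open>auto simp: Pfe_def\<close>)

end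

theorem theorem4p6:
  fixes R :: "'a::ordered_ab_group_add set \<Rightarrow> 'a \<Rightarrow> bool"
  assumes "system_of_ideals R"
  shows "regular_entailment (regularisation R)
    \<and> (\<forall>A b. R A b \<longrightarrow> regularisation R A {b})
    \<and> (\<forall>E. regular_entailment E \<and> (\<forall>A b. R A b \<longrightarrow> E A {b}) \<longrightarrow> regularisation R \<le> E)"
proof (intro conjI allI impI)
  show "regular_entailment (regularisation R)"
    by (rule system_of_ideals.regularisation_regular_entailment[OF assms])
  show "regularisation R A {b}" if "R A b" for A b
    by (rule system_of_ideals.regularisation_coarser[OF assms that])
  show "regularisation R \<le> E"
    if E: "regular_entailment E \<and> (\<forall>A b. R A b \<longrightarrow> E A {b})" for E
    by (rule regular_entailment.regularisation_le[OF conjunct1[OF E] assms]) (use E in simp)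
qed

end
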